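(* Let $0<q<1$ and $0<b<1$. Then the $(b;q)$-numbers $[x]_{(b;q)}$ are continuously strongly log-concave in $x$; that is, for all real $x\ge y\ge r\ge 0$, $$[x]_{(b;q)}\,[y]_{(b;q)}\ \ge\ [x+r]_{(b;q)}\,[y-r]_{(b;q)}.$$
   Context: The $(b;q)$-number of $x$ is defined by $$[x]_{(b;q)}:=\frac{(1-q^x)(1-bq)}{(1-q)(1-bq^x)}.$$ *)

theory Defs
  imports Complex_Main
begin

definition bq_number :: "real \<Rightarrow> real \<Rightarrow> real \<Rightarrow> real" where
  "bq_number b q x =
     ((1 - q powr x) * (1 - b * q)) / ((1 - q) * (1 - b * q powr x))"

definition continuously_strongly_log_concave :: "(real \<Rightarrow> real) \<Rightarrow> bool" where
  "continuously_strongly_log_concave f \<longleftrightarrow>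
     (\<forall>x y r. x \<ge> y \<and> y \<ge> r \<and> r \<ge> 0 \<longrightarrow> f x * f y \<ge> f (x + r) * f (y - r))"

end

(* With X = q^x, Z = q^(y-r) and t = q^r the claim compares the function
   (1 - u) / (1 - b u) at the pairs (X, Z t) and (X t, Z), which have the same product P = X Z t.
   For a fixed product, the product of the two values depends only on the sum of the pair and
   decreases in it; the sums differ by (1 - t) (Z - X) \<ge> 0. *)
theory Submission
  imports Defs
begin

lemma ratio_product_mono:
  fixes b X Z t :: real
  assumes b: "0 < b" "b < 1" and X: "0 < X" "X \<le> Z" and Z: "Z \<le> 1" and t: "0 < t" "t \<le> 1"
  shows "((1 - X * t) * (1 - Z)) / ((1 - b * (X * t)) * (1 - b * Z))
           \<le> ((1 - X) * (1 - Z * t)) / ((1 - b * X) * (1 - b * (Z * t)))"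
proof -
  have pos: "1 - b * u > 0" if "0 \<le> u" "u \<le> 1" for u
    using mult_left_le[of u b] that b by linarith
  have "X * t \<le> 1" "Z * t \<le> 1" "X * (Z * t) \<le> 1"
    using assms by (auto intro!: mult_le_one)
  then have den: "(1 - b * (X * t)) * (1 - b * Z) > 0" "(1 - b * X) * (1 - b * (Z * t)) > 0"
    and P: "1 - b * (X * (Z * t)) > 0"
    using assms by (intro mult_pos_pos pos; simp)+
  \<comment> \<open>Put S = X + Z t, S' = X t + Z and P = X Z t. Numerators multiply to 1 - S + P,
    denominators to 1 - b S + b^2 P (likewise for S'), so the S S' terms cancel and (S' - S) (1 +
    b^2 P - b (1 + P)) remains.\<close>
  have "(1 - X) * (1 - Z * t) * ((1 - b * (X * t)) * (1 - b * Z))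
          - (1 - X * t) * (1 - Z) * ((1 - b * X) * (1 - b * (Z * t)))
        = (1 - t) * (Z - X) * ((1 - b) * (1 - b * (X * (Z * t))))"
    by (simp add: algebra_simps)
  also have "\<dots> \<ge> 0"
    using assms P by simp
  finally show ?thesis
    using den by (simp add: divide_simps)
qed

theorem theorem6:
  fixes b q :: real
  assumes "0 < q" and "q < 1" and "0 < b" and "b < 1"
  shows "continuously_strongly_log_concave (bq_number b q)"
  unfolding continuously_strongly_log_concave_def
proof (intro allI impI)
  fix x y r :: real
  assume *: "x \<ge> y \<and> y \<ge> r \<and> r \<ge> 0"
  \<comment> \<open>Starting from \<open>y - r\<close> rather than \<open>y\<close> makes all four
    powers monomials in X, Z, t.\<close>
  define X Z t where "X = q powr x" and "Z = q powr (y - r)" and "t = q powr r"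
  note defs = this
  have powers: "q powr (x + r) = X * t" "q powr y = Z * t"
    by (simp_all add: defs flip: powr_add)
  have decreasing: "q powr v \<le> q powr u" if "u \<le> v" for u v
    using powr_mono'[of u v q] that assms by simp
  \<comment> \<open>X \<le> Z comes from y - r \<le> y \<le> x, as q < 1 reverses the order.\<close>
  have "0 < X" "X \<le> Z" "Z \<le> 1" "0 < t" "t \<le> 1"
    using * decreasing[of "y - r" x] decreasing[of 0 "y - r"] decreasing[of 0 r] assms
    by (simp_all add: defs)
  note le = ratio_product_mono[OF assms(3,4) this]
  define c where "c = (1 - b * q) / (1 - q)"
  have factor: "bq_number b q u = c * ((1 - q powr u) / (1 - b * q powr u))" for u
    by (simp add: bq_number_def c_def mult.commute)
  show "bq_number b q x * bq_number b q y \<ge> bq_number b q (x + r) * bq_number b q (y - r)"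
    \<comment> \<open>Each side carries the constant \<open>c\<close> twice, and
      \<open>c * c\<close> is nonnegative as a square.\<close>
    using mult_left_mono[OF le, of "c * c"]
    by (simp add: factor powers flip: X_def Z_def) (simp add: ac_simps)
qed

end
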